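(* For any partitions $\mu\subset\lambda$, the skew Schur polynomial $U_{\lambda/\mu}$ satisfies $$U_{\lambda/\mu}=\sum_\nu c^\lambda_{\mu\nu}\,U_\nu,$$ where the sum is over partitions $\nu$ and the coefficients $c^\lambda_{\mu\nu}$ are the structure constants in $U_\mu\cdot U_\nu=\sum_\lambda c^\lambda_{\mu\nu}\,U_\lambda$.
   Context: An integer sequence (integer vector) is a sequence $\alpha=(\alpha_1,\alpha_2,\ldots)$ of integers with only finitely many nonzero terms; it is a partition if $\alpha_i\ge\alpha_{i+1}\ge 0$ for all $i$. For partitions, $\mu\subset\lambda$ means $\mu_i\le\lambda_i$ for all $i$, i.e. containment of Young diagrams, and $\lambda/\mu$ is the resulting skew diagram. Let $\mathbb{A}=\mathbb{Z}[u_1,u_2,\ldots]$ be the polynomial ring in countably many independent variables, with $u_0=1$ and $u_r=0$ for $r<0$. For an integer vector $\alpha$ put $u_\alpha=\prod_i u_{\alpha_i}$. For $i<j$ let $R_{ij}(\alpha)=(\alpha_1,\ldots,\alpha_i+1,\ldots,\alpha_j-1,\ldots)$; a raising operator $R$ is a monomial in the $R_{ij}$, and $R\,u_\alpha:=u_{R\alpha}$ (the operator acts on the index $\alpha$). The Schur polynomial of an integer vector $\alpha$ is $$U_\alpha:=\prod_{i<j}(1-R_{ij})\,u_\alpha\in\mathbb{A};$$ after formal expansion only finitely many summands are nonzero. The $U_\lambda$ for $\lambda$ a partition form a $\mathbb{Z}$-basis of $\mathbb{A}$. The Kostka numbers $K_{\lambda/\mu,\alpha}$ are defined by $u_\alpha\,U_\mu=\sum_{\lambda\supset\mu}K_{\lambda/\mu,\alpha}\,U_\lambda$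 (sum over partitions $\lambda\supset\mu$); for $\alpha$ a composition with $|\alpha|=|\lambda/\mu|$, $K_{\lambda/\mu,\alpha}$ is the number of semistandard tableaux of shape $\lambda/\mu$ and content $\alpha$. Write $K_{\lambda,\mu}$ when the inner shape is empty. The matrix $\{K_{\lambda,\mu}\}$ indexed by partitions is lower unitriangular with respect to dominance order, so the equations $U_\lambda=\sum_\mu K_{\lambda,\mu}\,t_\mu$ define a $\mathbb{Z}$-basis $\{t_\lambda\}$ of $\mathbb{A}$ indexed by partitions. The skew Schur polynomial is $U_{\lambda/\mu}:=\sum_\nu K_{\lambda/\mu,\nu}\,t_\nu$ (sum over partitions $\nu$). *)

theory Defs
  imports Main "HOL-Library.Poly_Mapping" "HOL-Library.Groups_Big_Fun"
begin

text \<open>Integer vectors, with positions numbered from 0.\<close>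

type_synonym intvec = "nat \<Rightarrow>\<^sub>0 int"

definition is_partition :: "intvec \<Rightarrow> bool" where
  "is_partition \<alpha> \<longleftrightarrow>
     (\<forall>i. Poly_Mapping.lookup \<alpha> i \<ge> Poly_Mapping.lookup \<alpha> (Suc i) \<and> Poly_Mapping.lookup \<alpha> (Suc i) \<ge> 0)"

definition contained :: "intvec \<Rightarrow> intvec \<Rightarrow> bool" where
  "contained \<mu> lam \<longleftrightarrow> (\<forall>i. Poly_Mapping.lookup \<mu> i \<le> Poly_Mapping.lookup lam i)"

text \<open>The polynomial ring \<open>\<int>[u\<^sub>1, u\<^sub>2, \<dots>]\<close>: finitely supported integer combinations
  of monomials, a monomial being a finitely supported exponent vector. The exponent
  of \<open>u\<^sub>r\<close> is stored at position \<open>r - 1\<close>, so that there is no superfluous variable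
  besides \<open>u\<^sub>1, u\<^sub>2, \<dots>\<close>.\<close>

type_synonym upoly = "(nat \<Rightarrow>\<^sub>0 nat) \<Rightarrow>\<^sub>0 int"

definition u :: "int \<Rightarrow> upoly" where
  "u r = (if r < 0 then 0 else if r = 0 then 1
          else Poly_Mapping.single (Poly_Mapping.single (nat (r - 1)) 1) 1)"

definition u_vec :: "intvec \<Rightarrow> upoly" where
  "u_vec \<alpha> = (\<Prod>i\<in>Poly_Mapping.keys \<alpha>. u (Poly_Mapping.lookup \<alpha> i))"

text \<open>The operator \<open>R\<^sub>i\<^sub>j\<close> increases entry \<open>i\<close> and decreases entry \<open>j\<close> by one, and these
  operators commute; \<open>raising S\<close> is the product of the \<open>R\<^sub>i\<^sub>j\<close> over \<open>(i, j) \<in> S\<close>.\<close>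

definition raising :: "(nat \<times> nat) set \<Rightarrow> intvec \<Rightarrow> intvec" where
  "raising S \<alpha> =
     \<alpha> + (\<Sum>(i, j)\<in>S. Poly_Mapping.single i 1 - Poly_Mapping.single j 1)"

text \<open>Formally expanding the product of all \<open>1 - R\<^sub>i\<^sub>j\<close> with \<open>i < j\<close> gives one signed
  summand for each finite set \<open>S\<close> of pairs, namely the pairs whose factor contributes
  \<open>- R\<^sub>i\<^sub>j\<close> rather than \<open>1\<close>. Only finitely many of these summands are nonzero
  (lemma \<open>finite_schur_summands\<close>), so the sum \<open>Sum_any\<close> over all \<open>S\<close> makes sense.\<close>

definition schur_summand :: "intvec \<Rightarrow> (nat \<times> nat) set \<Rightarrow> upoly" where
  "schur_summand \<alpha> S =
     ((- 1) ^ card S * u_vec (raising S \<alpha>) when finite S \<and> S \<subseteq> {(i, j). i < j})"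

definition schur :: "intvec \<Rightarrow> upoly" where
  "schur \<alpha> = Sum_any (schur_summand \<alpha>)"

lemma u_vec_neg_eq_0:
  assumes "Poly_Mapping.lookup \<alpha> i < 0"
  shows "u_vec \<alpha> = 0"
proof -
  have "i \<in> Poly_Mapping.keys \<alpha>" using assms by (simp add: in_keys_iff)
  moreover have "u (Poly_Mapping.lookup \<alpha> i) = 0" using assms by (simp add: u_def)
  ultimately show ?thesis unfolding u_vec_def
    by (intro prod_zero) auto
qed

lemma finite_schur_summands: "finite {S. schur_summand \<alpha> S \<noteq> 0}"
proof -
  obtain n where n: "\<And>k. k \<ge> n \<Longrightarrow> Poly_Mapping.lookup \<alpha> k = 0"
  proof
    fix k assume "k \<ge> Suc (Max (insert 0 (Poly_Mapping.keys \<alpha>)))"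
    then have "k \<notin> Poly_Mapping.keys \<alpha>"
      by (metis Max_ge finite_insert finite_keys insertCI not_less_eq_eq)
    then show "Poly_Mapping.lookup \<alpha> k = 0" by (simp add: in_keys_iff)
  qed
  have "S \<subseteq> {..<n} \<times> {..<n}" if nz: "schur_summand \<alpha> S \<noteq> 0" for S
  proof (cases "S = {}")
    case False
    have S: "finite S" "S \<subseteq> {(i, j). i < j}" and unz: "u_vec (raising S \<alpha>) \<noteq> 0"
      using nz by (auto simp: schur_summand_def when_def split: if_splits)
    define m where "m = Max (snd ` S)"
    have le: "j \<le> m" if "(i, j) \<in> S" for i j
      unfolding m_def using S(1) that by (metis Max_ge finite_imageI image_eqI snd_conv)
    have lt: "i < m" if "(i, j) \<in> S" for i j
      using le[OF that] S(2) that by auto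
    have "m \<in> snd ` S"
      unfolding m_def using S(1) False by (intro Max_in) auto
    then obtain i where im: "(i, m) \<in> S" by auto
    have "Poly_Mapping.lookup (\<Sum>(i, j)\<in>S. Poly_Mapping.single i 1 - Poly_Mapping.single j 1 :: intvec) m
        = (\<Sum>p\<in>S. if snd p = m then - 1 else 0)"
      unfolding lookup_sum
      by (intro sum.cong) (auto simp: lookup_minus lookup_single when_def dest: lt)
    also have "\<dots> = (if snd (i, m) = m then - 1 else 0)
        + (\<Sum>p\<in>S - {(i, m)}. if snd p = m then - 1 else 0)"
      using S(1) im by (rule sum.remove)
    also have "\<dots> \<le> - 1"
      using sum_nonpos[of "S - {(i, m)}" "\<lambda>p. if snd p = m then - 1 else (0::int)"] by simp
    finally have neg: "Poly_Mapping.lookup (raising S \<alpha>) m \<le> Poly_Mapping.lookup \<alpha> m - 1"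
      by (simp add: raising_def lookup_add)
    have "m < n"
    proof (rule ccontr)
      assume "\<not> m < n"
      then have "Poly_Mapping.lookup (raising S \<alpha>) m < 0" using neg n[of m] by simp
      then show False using unz u_vec_neg_eq_0 by blast
    qed
    then show ?thesis using le lt by fastforce
  qed auto
  then have "{S. schur_summand \<alpha> S \<noteq> 0} \<subseteq> Pow ({..<n} \<times> {..<n})" by auto
  then show ?thesis by (rule finite_subset) simp
qed

text \<open>The coefficients of a polynomial in the basis of Schur polynomials indexed by
  partitions.\<close>

definition schur_coeffs :: "upoly \<Rightarrow> (intvec \<Rightarrow>\<^sub>0 int)" where
  "schur_coeffs x = (THE c. Poly_Mapping.keys c \<subseteq> {lam. is_partition lam} \<and>
     x = (\<Sum>lam\<in>Poly_Mapping.keys c. of_int (Poly_Mapping.lookup c lam) * schur lam))"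

text \<open>\<open>kostka lam \<mu> \<alpha>\<close> stands for \<open>K\<^bsub>lam/\<mu>,\<alpha>\<^esub>\<close>; the empty inner shape is \<open>\<mu> = 0\<close>.\<close>

definition kostka :: "intvec \<Rightarrow> intvec \<Rightarrow> intvec \<Rightarrow> int" where
  "kostka lam \<mu> \<alpha> = Poly_Mapping.lookup (schur_coeffs (u_vec \<alpha> * schur \<mu>)) lam"

text \<open>The family \<open>t\<close> is only meaningful on partitions; the value 0 elsewhere is a
  normalization that makes it unique.\<close>

definition t_basis :: "intvec \<Rightarrow> upoly" where
  "t_basis = (THE t.
     (\<forall>lam. is_partition lam \<longrightarrow>
        schur lam = Sum_any (\<lambda>\<mu>. of_int (kostka lam 0 \<mu>) * t \<mu> when is_partition \<mu>)) \<and>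
     (\<forall>\<mu>. \<not> is_partition \<mu> \<longrightarrow> t \<mu> = 0))"

definition skew_schur :: "intvec \<Rightarrow> intvec \<Rightarrow> upoly" where
  "skew_schur lam \<mu> =
     Sum_any (\<lambda>\<nu>. of_int (kostka lam \<mu> \<nu>) * t_basis \<nu> when is_partition \<nu>)"

text \<open>\<open>structure_const lam \<mu> \<nu>\<close> is the coefficient of \<open>schur lam\<close> in
  \<open>schur \<mu> * schur \<nu>\<close>.\<close>

definition structure_const :: "intvec \<Rightarrow> intvec \<Rightarrow> intvec \<Rightarrow> int" where
  "structure_const lam \<mu> \<nu> = Poly_Mapping.lookup (schur_coeffs (schur \<mu> * schur \<nu>)) lam"

end

theory Submission imports Defs begin

text \<open>
  The statement is a formal consequence of \<open>U\<close> being a basis and of the Kostka matrix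
  being invertible. Expanding \<open>u\<^sub>\<nu> = \<Sum>\<^sub>\<kappa> K\<^bsub>\<kappa>,\<nu>\<^esub> U\<^sub>\<kappa>\<close> and multiplying by \<open>U\<^sub>\<mu>\<close> gives
  \<open>K\<^bsub>\<lambda>/\<mu>,\<nu>\<^esub> = \<Sum>\<^sub>\<kappa> K\<^bsub>\<kappa>,\<nu>\<^esub> c\<^sup>\<lambda>\<^bsub>\<mu>\<kappa>\<^esub>\<close> (\<open>kostka_eq_sum_structure_const\<close>); substituting this
  into \<open>\<Sum>\<^sub>\<nu> K\<^bsub>\<lambda>/\<mu>,\<nu>\<^esub> t\<^sub>\<nu>\<close> and summing over \<open>\<nu>\<close> first turns \<open>\<Sum>\<^sub>\<nu> K\<^bsub>\<kappa>,\<nu>\<^esub> t\<^sub>\<nu>\<close> into \<open>U\<^sub>\<kappa>\<close>.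

  The substance lies in the facts behind this. The monomials of the ring correspond to
  partitions, \<open>\<lambda>\<close> going to \<open>u\<^sub>\<lambda>\<close> (\<open>inj_on_expo\<close>, \<open>expo_surj\<close>). The transition matrix between
  the \<open>U\<^sub>\<lambda>\<close> and the \<open>u\<^sub>\<lambda>\<close> is unitriangular. Usually this is phrased with the dominance order,
  which requires sorting the raised vectors \<open>R\<lambda>\<close>. Here the sum of the squares of the entries,
  called the energy, is used instead: it is invariant under permutation, hence a function of
  the monomial alone, and a nontrivial raising operator strictly increases it on a
  partition (\<open>raising_degree_energy\<close>). Since raising operators preserve the degree and
  there are finitely many monomials of each degree, \<open>U\<close> is a basis degree by degree
  (\<open>schur_independent\<close>, \<open>homogeneous_in_schur_span\<close>). Homogeneity also makes all the sums
  in question finite.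

  Within a fixed degree the Kostka matrix expresses \<open>u\<close> in terms of \<open>U\<close>, so that its transposed
  inverse consists of the coefficients of \<open>U\<close> in terms of \<open>u\<close>. This determines \<open>t\<close> uniquely
  and shows that it exists (\<open>schur_eq_sum_t_basis\<close>).
\<close>

section \<open>Additive statistics of monomials\<close>

text \<open>For \<open>m\<close> the monomial of a vector \<open>\<alpha>\<close> with nonnegative entries, this is the sum of
  \<open>f (\<alpha>\<^sub>i - 1)\<close> over the nonzero entries of \<open>\<alpha>\<close> (lemma \<open>weight_expo\<close>): the variable
  stored at position \<open>r\<close> is \<open>u\<^bsub>r+1\<^esub>\<close>.\<close>

definition weight :: "(nat \<Rightarrow> int) \<Rightarrow> (nat \<Rightarrow>\<^sub>0 nat) \<Rightarrow> int" where
  "weight f m = (\<Sum>r\<in>Poly_Mapping.keys m. int (Poly_Mapping.lookup m r) * f r)"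

lemma weight_superset:
  assumes "finite I" "Poly_Mapping.keys m \<subseteq> I"
  shows "weight f m = (\<Sum>r\<in>I. int (Poly_Mapping.lookup m r) * f r)"
  unfolding weight_def using assms
  by (intro sum.mono_neutral_left) (auto simp: in_keys_iff)

lemma weight_zero [simp]: "weight f 0 = 0"
  by (simp add: weight_def)

lemma weight_single [simp]: "weight f (Poly_Mapping.single r 1) = f r"
  by (simp add: weight_def)

lemma weight_add: "weight f (m + m') = weight f m + weight f m'"
proof -
  define I where "I = Poly_Mapping.keys m \<union> Poly_Mapping.keys m'"
  have "finite I" "Poly_Mapping.keys m \<subseteq> I" "Poly_Mapping.keys m' \<subseteq> I"
    "Poly_Mapping.keys (m + m') \<subseteq> I"
    unfolding I_def using keys_add[of m m'] by auto
  then show ?thesis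
    by (simp add: weight_superset[of I] lookup_add algebra_simps sum.distrib)
qed

lemma weight_sum: "weight f (\<Sum>i\<in>I. g i) = (\<Sum>i\<in>I. weight f (g i))"
  by (induction I rule: infinite_finite_induct) (simp_all add: weight_add)

lemma weight_diff: "weight (\<lambda>r. f r - g r) m = weight f m - weight g m"
  by (simp add: weight_def algebra_simps sum_subtractf)

lemma weight_indicator: "weight (\<lambda>r. of_bool (r = s)) m = int (Poly_Mapping.lookup m s)"
proof -
  have "weight (\<lambda>r. of_bool (r = s)) m
      = (\<Sum>r\<in>insert s (Poly_Mapping.keys m). if r = s then int (Poly_Mapping.lookup m r) else 0)"
    by (subst weight_superset[of "insert s (Poly_Mapping.keys m)"]) (auto intro!: sum.cong)
  also have "\<dots> = int (Poly_Mapping.lookup m s)"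
    by (subst sum.delta) auto
  finally show ?thesis .
qed

lemma weight_nonneg:
  assumes "\<And>r. f r \<ge> 0"
  shows "weight f m \<ge> 0"
  unfolding weight_def by (intro sum_nonneg) (use assms in auto)

definition mono_degree :: "(nat \<Rightarrow>\<^sub>0 nat) \<Rightarrow> int" where
  "mono_degree = weight (\<lambda>r. int r + 1)"

text \<open>The sum of the squares of the entries of any vector with this monomial. It orders the
  monomials of one degree in the way required for triangularity, in place of the dominance
  order.\<close>

definition mono_energy :: "(nat \<Rightarrow>\<^sub>0 nat) \<Rightarrow> int" where
  "mono_energy = weight (\<lambda>r. (int r + 1)\<^sup>2)"

text \<open>The number of factors \<open>u\<^sub>s\<close> with \<open>s > r\<close>. For the monomial of a partition these
  numbers are the parts of the conjugate partition.\<close>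

definition tail :: "(nat \<Rightarrow>\<^sub>0 nat) \<Rightarrow> nat \<Rightarrow> int" where
  "tail m r = weight (\<lambda>s. of_bool (r \<le> s)) m"

lemma mono_eqI_tail:
  assumes "\<And>r. tail m r = tail m' r"
  shows "m = m'"
proof (rule poly_mapping_eqI)
  fix r
  have ind: "(\<lambda>s. of_bool (r \<le> s) - of_bool (Suc r \<le> s)) = (\<lambda>s. of_bool (s = r) :: int)"
    by (auto simp: fun_eq_iff)
  have "int (Poly_Mapping.lookup m'' r) = tail m'' r - tail m'' (Suc r)" for m''
    unfolding tail_def weight_diff[symmetric] ind weight_indicator ..
  then show "Poly_Mapping.lookup m r = Poly_Mapping.lookup m' r"
    using assms by (metis of_nat_eq_iff)
qed

text \<open>This bounds both the exponents and the variables that occur in a given degree.\<close>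

lemma lookup_le_mono_degree:
  "int (Poly_Mapping.lookup m r) * (int r + 1) \<le> mono_degree m"
proof -
  have "int (Poly_Mapping.lookup m r) * (int r + 1)
      \<le> (\<Sum>r\<in>insert r (Poly_Mapping.keys m). int (Poly_Mapping.lookup m r) * (int r + 1))"
    by (rule member_le_sum) auto
  also have "\<dots> = mono_degree m"
    unfolding mono_degree_def by (rule weight_superset[symmetric]) auto
  finally show ?thesis .
qed

lemma finite_mono_degree: "finite {m. mono_degree m = n}"
proof -
  define F where "F = {f :: nat \<Rightarrow> nat. \<forall>r. (r \<in> {..<nat n} \<longrightarrow> f r \<in> {..nat n}) \<and> (r \<notin> {..<nat n} \<longrightarrow> f r = 0)}"
  have "finite F"
    unfolding F_def by (rule finite_set_of_finite_funs) auto
  moreover have "Poly_Mapping.lookup ` {m. mono_degree m = n} \<subseteq> F"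
  proof (clarsimp simp: F_def)
    fix m :: "nat \<Rightarrow>\<^sub>0 nat" and r :: nat
    let ?a = "Poly_Mapping.lookup m r"
    have le: "int ?a * (int r + 1) \<le> mono_degree m" by (rule lookup_le_mono_degree)
    have "int ?a * 1 \<le> int ?a * (int r + 1)" by (intro mult_left_mono) auto
    moreover have "int r < mono_degree m" if "?a \<noteq> 0"
    proof -
      have "1 * (int r + 1) \<le> int ?a * (int r + 1)" using that by (intro mult_right_mono) auto
      then have "1 * (int r + 1) \<le> mono_degree m" using le by (rule order_trans)
      then show ?thesis by simp
    qed
    ultimately show "(r < nat (mono_degree m) \<longrightarrow> ?a \<le> nat (mono_degree m)) \<and>
        (\<not> r < nat (mono_degree m) \<longrightarrow> ?a = 0)"
      using le by force
  qed
  moreover have "inj_on Poly_Mapping.lookup {m :: nat \<Rightarrow>\<^sub>0 nat. mono_degree m = n}"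
    by (intro inj_onI poly_mapping_eqI) simp
  ultimately show ?thesis
    by (meson finite_imageD finite_subset)
qed

lemma mono_degree_eq_0: "mono_degree m = 0 \<Longrightarrow> m = 0"
proof (rule poly_mapping_eqI)
  fix r assume "mono_degree m = 0"
  then have "int (Poly_Mapping.lookup m r) * (int r + 1) \<le> 0"
    using lookup_le_mono_degree[of m r] by simp
  then show "Poly_Mapping.lookup m r = Poly_Mapping.lookup 0 r"
    by (simp add: mult_le_0_iff)
qed

section \<open>Partitions and monomials\<close>

definition expo :: "intvec \<Rightarrow> (nat \<Rightarrow>\<^sub>0 nat)" where
  "expo \<alpha> = (\<Sum>i\<in>Poly_Mapping.keys \<alpha>. Poly_Mapping.single (nat (Poly_Mapping.lookup \<alpha> i - 1)) 1)"

lemma prod_single: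
  "(\<Prod>i\<in>I. Poly_Mapping.single (g i) (1::int)) = Poly_Mapping.single (\<Sum>i\<in>I. g i) 1"
  by (induction I rule: infinite_finite_induct) (simp_all add: mult_single)

lemma u_vec_eq_single:
  assumes "\<And>i. Poly_Mapping.lookup \<alpha> i \<ge> 0"
  shows "u_vec \<alpha> = Poly_Mapping.single (expo \<alpha>) 1"
proof -
  have "u_vec \<alpha> = (\<Prod>i\<in>Poly_Mapping.keys \<alpha>.
      Poly_Mapping.single (Poly_Mapping.single (nat (Poly_Mapping.lookup \<alpha> i - 1)) 1) 1)"
    unfolding u_vec_def
  proof (rule prod.cong)
    fix i assume "i \<in> Poly_Mapping.keys \<alpha>"
    then have "Poly_Mapping.lookup \<alpha> i > 0"
      using assms[of i] by (simp add: in_keys_iff)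
    then show "u (Poly_Mapping.lookup \<alpha> i)
        = Poly_Mapping.single (Poly_Mapping.single (nat (Poly_Mapping.lookup \<alpha> i - 1)) 1) 1"
      by (simp add: u_def)
  qed simp
  then show ?thesis by (simp add: prod_single expo_def)
qed

lemma weight_expo:
  "weight f (expo \<alpha>) = (\<Sum>i\<in>Poly_Mapping.keys \<alpha>. f (nat (Poly_Mapping.lookup \<alpha> i - 1)))"
  by (simp only: expo_def weight_sum weight_single)

lemma mono_degree_expo:
  assumes "\<And>i. Poly_Mapping.lookup \<alpha> i \<ge> 0" "finite I" "Poly_Mapping.keys \<alpha> \<subseteq> I"
  shows "mono_degree (expo \<alpha>) = (\<Sum>i\<in>I. Poly_Mapping.lookup \<alpha> i)"
proof -
  have "mono_degree (expo \<alpha>) = (\<Sum>i\<in>Poly_Mapping.keys \<alpha>. Poly_Mapping.lookup \<alpha> i)"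
    unfolding mono_degree_def weight_expo
    by (intro sum.cong refl) (use assms(1) in \<open>force simp: in_keys_iff order_less_le\<close>)
  also have "\<dots> = (\<Sum>i\<in>I. Poly_Mapping.lookup \<alpha> i)"
    using assms(2,3) by (intro sum.mono_neutral_left) (auto simp: in_keys_iff)
  finally show ?thesis .
qed

lemma mono_energy_expo:
  assumes "\<And>i. Poly_Mapping.lookup \<alpha> i \<ge> 0" "finite I" "Poly_Mapping.keys \<alpha> \<subseteq> I"
  shows "mono_energy (expo \<alpha>) = (\<Sum>i\<in>I. (Poly_Mapping.lookup \<alpha> i)\<^sup>2)"
proof -
  have "mono_energy (expo \<alpha>) = (\<Sum>i\<in>Poly_Mapping.keys \<alpha>. (Poly_Mapping.lookup \<alpha> i)\<^sup>2)"
    unfolding mono_energy_def weight_expo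
    by (intro sum.cong refl) (use assms(1) in \<open>force simp: in_keys_iff order_less_le\<close>)
  also have "\<dots> = (\<Sum>i\<in>I. (Poly_Mapping.lookup \<alpha> i)\<^sup>2)"
    using assms(2,3) by (intro sum.mono_neutral_left) (auto simp: in_keys_iff)
  finally show ?thesis .
qed

lemma partition_nonneg:
  assumes "is_partition lam"
  shows "Poly_Mapping.lookup lam i \<ge> 0"
proof -
  have "0 \<le> Poly_Mapping.lookup lam (Suc i)" "Poly_Mapping.lookup lam (Suc i) \<le> Poly_Mapping.lookup lam i"
    using assms by (simp_all add: is_partition_def)
  then show ?thesis by (rule order_trans)
qed

lemma partition_antimono:
  assumes "is_partition lam" "i \<le> j"
  shows "Poly_Mapping.lookup lam j \<le> Poly_Mapping.lookup lam i"
  using lift_Suc_antimono_le[of "Poly_Mapping.lookup lam", OF _ assms(2)] assms(1)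
  by (simp add: is_partition_def)

lemma finite_downset_nat:
  fixes X :: "nat set"
  assumes "finite X" "\<And>i j. j \<in> X \<Longrightarrow> i \<le> j \<Longrightarrow> i \<in> X"
  shows "i \<in> X \<longleftrightarrow> i < card X"
proof -
  define n where "n = (LEAST n. n \<notin> X)"
  have "\<exists>n. n \<notin> X" using assms(1) by (metis ex_new_if_finite infinite_UNIV_nat)
  then have "n \<notin> X" unfolding n_def by (rule LeastI_ex)
  moreover have "i \<in> X" if "i < n" for i using that not_less_Least unfolding n_def by blast
  ultimately have "X = {..<n}" using assms(2) by (meson lessThan_iff not_less subsetI subset_antisym)
  then show ?thesis by simp
qed

text \<open>The Young diagram read by rows and by columns. It recovers a partition from its
  monomial, and conversely suggests the preimage of a monomial, so it yields both halves
  of the correspondence between partitions and monomials.\<close>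

lemma less_tail_expo_iff:
  assumes "is_partition lam"
  shows "int i < tail (expo lam) r \<longleftrightarrow> int r < Poly_Mapping.lookup lam i"
proof -
  define X where "X = {i. int r < Poly_Mapping.lookup lam i}"
  have sub: "X \<subseteq> Poly_Mapping.keys lam" by (auto simp: X_def in_keys_iff)
  then have fin: "finite X" by (rule finite_subset) simp
  have "tail (expo lam) r = (\<Sum>i\<in>Poly_Mapping.keys lam. if i \<in> X then 1 else 0)"
    unfolding tail_def weight_expo
  proof (rule sum.cong)
    fix i assume "i \<in> Poly_Mapping.keys lam"
    then have "Poly_Mapping.lookup lam i > 0"
      using partition_nonneg[OF assms, of i] by (simp add: in_keys_iff)
    then show "of_bool (r \<le> nat (Poly_Mapping.lookup lam i - 1)) = (if i \<in> X then 1 else 0 :: int)"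
      by (auto simp: X_def)
  qed simp
  also have "\<dots> = int (card X)"
    using sub by (simp add: sum.If_cases Int_absorb1)
  finally have "tail (expo lam) r = int (card X)" .
  moreover have "i \<in> X \<longleftrightarrow> i < card X"
    using fin by (rule finite_downset_nat)
      (auto simp: X_def intro: less_le_trans partition_antimono[OF assms])
  ultimately show ?thesis by (simp add: X_def)
qed

lemma inj_on_expo: "inj_on expo (Collect is_partition)"
proof (rule inj_onI, rule poly_mapping_eqI)
  fix lam \<mu> i
  assume p: "lam \<in> Collect is_partition" "\<mu> \<in> Collect is_partition" and e: "expo lam = expo \<mu>"
  have parts: "is_partition lam" "is_partition \<mu>" using p by auto
  have iff: "int r < Poly_Mapping.lookup lam i \<longleftrightarrow> int r < Poly_Mapping.lookup \<mu> i" for r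
    unfolding less_tail_expo_iff[OF parts(1), symmetric] less_tail_expo_iff[OF parts(2), symmetric] e ..
  have nn: "Poly_Mapping.lookup lam i \<ge> 0" "Poly_Mapping.lookup \<mu> i \<ge> 0"
    using parts by (auto intro: partition_nonneg)
  show "Poly_Mapping.lookup lam i = Poly_Mapping.lookup \<mu> i"
    using iff[of "nat (Poly_Mapping.lookup lam i)"] iff[of "nat (Poly_Mapping.lookup \<mu> i)"] nn
    by simp
qed

text \<open>The preimage is the conjugate of the sequence of tails.\<close>

lemma expo_surj:
  obtains lam where "is_partition lam" "expo lam = m"
proof -
  define X where "X i = {r. int i < tail m r}" for i
  have tail_mono: "tail m r' \<le> tail m r" if "r \<le> r'" for r r'
    unfolding tail_def weight_def using that by (intro sum_mono mult_left_mono) auto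
  have tail_nn: "tail m r \<ge> 0" for r
    unfolding tail_def by (rule weight_nonneg) simp
  have tail_0: "tail m r = 0" if "r > Max (insert 0 (Poly_Mapping.keys m))" for r
  proof -
    have "\<not> r \<le> s" if "s \<in> Poly_Mapping.keys m" for s
      using \<open>r > _\<close> that Max_ge[of "insert 0 (Poly_Mapping.keys m)" s] by auto
    then show ?thesis unfolding tail_def weight_def by (intro sum.neutral) auto
  qed
  have fin: "finite (X i)" for i
  proof (rule finite_subset)
    show "X i \<subseteq> {..Max (insert 0 (Poly_Mapping.keys m))}"
    proof
      fix r assume "r \<in> X i"
      then have "tail m r \<noteq> 0" by (simp add: X_def)
      then show "r \<in> {..Max (insert 0 (Poly_Mapping.keys m))}"
        using tail_0[of r] by (meson atMost_iff not_less)
    qed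
  qed simp
  have mem: "r \<in> X i \<longleftrightarrow> r < card (X i)" for r i
    using fin by (rule finite_downset_nat) (auto simp: X_def dest: tail_mono)
  have supp: "finite {i. int (card (X i)) \<noteq> 0}"
  proof (rule finite_subset)
    show "{i. int (card (X i)) \<noteq> 0} \<subseteq> {..<nat (tail m 0)}"
    proof
      fix i assume "i \<in> {i. int (card (X i)) \<noteq> 0}"
      then have "0 \<in> X i" using mem[of 0 i] by simp
      then show "i \<in> {..<nat (tail m 0)}" by (simp add: X_def)
    qed
  qed simp
  define lam where "lam = Abs_poly_mapping (\<lambda>i. int (card (X i)))"
  have lookup: "Poly_Mapping.lookup lam i = int (card (X i))" for i
    unfolding lam_def by (simp add: lookup_Abs_poly_mapping[OF supp])
  have part: "is_partition lam"
    unfolding is_partition_def lookup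
  proof (intro allI conjI)
    fix i
    have "X (Suc i) \<subseteq> X i" by (auto simp: X_def)
    then show "int (card (X (Suc i))) \<le> int (card (X i))" using fin by (simp add: card_mono)
  qed simp
  have "expo lam = m"
  proof (rule mono_eqI_tail)
    fix r
    have iff: "int i < tail (expo lam) r \<longleftrightarrow> int i < tail m r" for i
      unfolding less_tail_expo_iff[OF part] lookup using mem[of r i] by (simp add: X_def)
    have "tail (expo lam) r \<ge> 0"
      unfolding tail_def by (rule weight_nonneg) simp
    then show "tail (expo lam) r = tail m r"
      using iff[of "nat (tail (expo lam) r)"] iff[of "nat (tail m r)"] tail_nn[of r] by simp
  qed
  with part show thesis by (rule that)
qed

definition partitions :: "int \<Rightarrow> intvec set" where
  "partitions n = {lam. is_partition lam \<and> mono_degree (expo lam) = n}"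

lemma finite_partitions [simp]: "finite (partitions n)"
proof (rule inj_on_finite)
  show "inj_on expo (partitions n)"
    by (rule inj_on_subset[OF inj_on_expo]) (auto simp: partitions_def)
  show "expo ` partitions n \<subseteq> {m. mono_degree m = n}" by (auto simp: partitions_def)
qed (rule finite_mono_degree)

lemma partitionsD: "lam \<in> partitions n \<Longrightarrow> is_partition lam"
  by (simp add: partitions_def)

section \<open>Raising operators increase the energy\<close>

lemma sum_raise:
  fixes f :: "nat \<Rightarrow> int" and S :: "(nat \<times> nat) set"
  defines "\<delta> \<equiv> (\<Sum>(i, j)\<in>S. Poly_Mapping.single i 1 - Poly_Mapping.single j 1 :: intvec)"
  assumes "finite I" "fst ` S \<subseteq> I" "snd ` S \<subseteq> I"
  shows "(\<Sum>k\<in>I. f k * Poly_Mapping.lookup \<delta> k) = (\<Sum>(i, j)\<in>S. f i - f j)"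
proof -
  have "(\<Sum>k\<in>I. f k * Poly_Mapping.lookup \<delta> k)
      = (\<Sum>k\<in>I. \<Sum>p\<in>S. (if fst p = k then f k else 0) - (if snd p = k then f k else 0))"
    unfolding \<delta>_def lookup_sum sum_distrib_left
    by (intro sum.cong refl) (auto simp: lookup_minus lookup_single when_def split: prod.splits)
  also have "\<dots> = (\<Sum>p\<in>S. (\<Sum>k\<in>I. if fst p = k then f k else 0) - (\<Sum>k\<in>I. if snd p = k then f k else 0))"
    by (subst sum.swap) (simp add: sum_subtractf)
  also have "\<dots> = (\<Sum>p\<in>S. f (fst p) - f (snd p))"
    using assms(2-) by (intro sum.cong refl) (auto simp: sum.delta')
  finally show ?thesis by (simp add: case_prod_unfold)
qed

text \<open>Raising adds a vector \<open>\<delta>\<close>, and the energy changes by \<open>2\<langle>\<lambda>, \<delta>\<rangle> + \<langle>\<delta>, \<delta>\<rangle>\<close>. The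
  first term is nonnegative because each factor \<open>R\<^sub>i\<^sub>j\<close> contributes \<open>\<lambda>\<^sub>i - \<lambda>\<^sub>j \<ge> 0\<close> to it. The
  second is positive unless \<open>\<delta> = 0\<close>, which is excluded by pairing \<open>\<delta>\<close> with the vector
  \<open>(0, 1, 2, \<dots>)\<close>: each factor contributes \<open>i - j < 0\<close> to that pairing.\<close>

lemma raising_degree_energy:
  assumes lam: "is_partition lam"
    and S: "finite S" "S \<subseteq> {(i, j). i < j}" "S \<noteq> {}"
    and nn: "\<And>i. Poly_Mapping.lookup (raising S lam) i \<ge> 0"
  shows "mono_degree (expo (raising S lam)) = mono_degree (expo lam)"
    and "mono_energy (expo (raising S lam)) > mono_energy (expo lam)"
proof -
  define \<delta> where "\<delta> = (\<Sum>(i, j)\<in>S. Poly_Mapping.single i 1 - Poly_Mapping.single j 1 :: intvec)"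
  define I where "I = Poly_Mapping.keys lam \<union> Poly_Mapping.keys (raising S lam) \<union> fst ` S \<union> snd ` S"
  have I: "finite I" "Poly_Mapping.keys lam \<subseteq> I" "Poly_Mapping.keys (raising S lam) \<subseteq> I"
    "fst ` S \<subseteq> I" "snd ` S \<subseteq> I"
    unfolding I_def using S(1) by auto
  have lookup: "Poly_Mapping.lookup (raising S lam) k = Poly_Mapping.lookup lam k + Poly_Mapping.lookup \<delta> k" for k
    by (simp add: raising_def \<delta>_def lookup_add)
  note pairing = sum_raise[OF I(1,4,5), folded \<delta>_def]
  show "mono_degree (expo (raising S lam)) = mono_degree (expo lam)"
    using pairing[of "\<lambda>_. 1"]
    by (simp add: mono_degree_expo[OF nn I(1,3)] mono_degree_expo[OF partition_nonneg[OF lam] I(1,2)]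
        lookup sum.distrib case_prod_unfold)
  have "(\<Sum>k\<in>I. int k * Poly_Mapping.lookup \<delta> k) = (\<Sum>(i, j)\<in>S. int i - int j)"
    by (rule pairing)
  also have "\<dots> < 0"
    using sum_strict_mono[of S "\<lambda>(i, j). int i - int j" "\<lambda>_. 0"] S by fastforce
  finally have "(\<Sum>k\<in>I. int k * Poly_Mapping.lookup \<delta> k) \<noteq> 0" by simp
  then obtain k where k: "k \<in> I" "Poly_Mapping.lookup \<delta> k \<noteq> 0"
    by (rule sum.not_neutral_contains_not_neutral) auto
  have sq: "(\<Sum>k\<in>I. (Poly_Mapping.lookup \<delta> k)\<^sup>2) > 0"
    using I(1) k by (intro sum_pos2[of _ k]) auto
  have lin: "(\<Sum>k\<in>I. Poly_Mapping.lookup lam k * Poly_Mapping.lookup \<delta> k) \<ge> 0"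
    unfolding pairing using S(2) by (intro sum_nonneg) (auto intro!: partition_antimono[OF lam] dest!: subsetD[OF S(2)])
  have "mono_energy (expo (raising S lam)) = mono_energy (expo lam)
      + 2 * (\<Sum>k\<in>I. Poly_Mapping.lookup lam k * Poly_Mapping.lookup \<delta> k)
      + (\<Sum>k\<in>I. (Poly_Mapping.lookup \<delta> k)\<^sup>2)"
    by (simp add: mono_energy_expo[OF nn I(1,3)] mono_energy_expo[OF partition_nonneg[OF lam] I(1,2)]
        lookup power2_sum sum.distrib sum_distrib_left algebra_simps)
  with lin sq show "mono_energy (expo (raising S lam)) > mono_energy (expo lam)" by linarith
qed

lemma of_int_mult_eq_frag_cmul: "of_int c * p = frag_cmul c p" for p :: upoly
proof -
  have "of_int c * p = Poly_Mapping.single 0 c * p"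
    unfolding single_of_int[of c, symmetric] by (simp del: single_of_int)
  also have "\<dots> = Poly_Mapping.map ((*) c) p"
    by (rule mult_map_scale_conv_mult[symmetric])
  also have "\<dots> = frag_cmul c p"
    by (rule poly_mapping_eqI) (simp add: Poly_Mapping.map.rep_eq when_def)
  finally show ?thesis .
qed

lemma schur_unitriangular:
  assumes lam: "is_partition lam" and m: "m \<in> Poly_Mapping.keys (schur lam - u_vec lam)"
  shows "mono_degree m = mono_degree (expo lam)" "mono_energy m > mono_energy (expo lam)"
proof -
  define F where "F = insert {} {S. schur_summand lam S \<noteq> 0}"
  have fin: "finite F" unfolding F_def using finite_schur_summands by simp
  have "schur lam = (\<Sum>S\<in>F. schur_summand lam S)"
    unfolding schur_def using fin by (rule Sum_any.expand_superset) (auto simp: F_def)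
  also have "\<dots> = schur_summand lam {} + (\<Sum>S\<in>F - {{}}. schur_summand lam S)"
    using fin by (rule sum.remove) (simp add: F_def)
  also have "schur_summand lam {} = u_vec lam"
    by (simp add: schur_summand_def raising_def)
  finally have "schur lam - u_vec lam = (\<Sum>S\<in>F - {{}}. schur_summand lam S)" by simp
  with m obtain S where S: "S \<noteq> {}" "m \<in> Poly_Mapping.keys (schur_summand lam S)"
    using keys_sum[of "schur_summand lam" "F - {{}}"] by auto
  then have fS: "finite S" "S \<subseteq> {(i, j). i < j}"
    by (auto simp: schur_summand_def when_def split: if_splits)
  have mem: "m \<in> Poly_Mapping.keys (of_int ((- 1) ^ card S) * u_vec (raising S lam))"
    using S(2) fS by (simp add: schur_summand_def)
  then have nz: "u_vec (raising S lam) \<noteq> 0" by auto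
  have nn: "Poly_Mapping.lookup (raising S lam) i \<ge> 0" for i
    using nz u_vec_neg_eq_0 by (meson not_le)
  have "m = expo (raising S lam)"
    using mem unfolding of_int_mult_eq_frag_cmul u_vec_eq_single[OF nn] by auto
  then show "mono_degree m = mono_degree (expo lam)" "mono_energy m > mono_energy (expo lam)"
    using raising_degree_energy[OF lam fS S(1) nn] by auto
qed

lemma lookup_schur:
  assumes "is_partition lam"
  shows "Poly_Mapping.lookup (schur lam) (expo lam) = 1"
    and "Poly_Mapping.lookup (schur lam) m \<noteq> 0 \<Longrightarrow> m \<noteq> expo lam \<Longrightarrow> mono_energy m > mono_energy (expo lam)"
    and "Poly_Mapping.lookup (schur lam) m \<noteq> 0 \<Longrightarrow> mono_degree m = mono_degree (expo lam)"
proof -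
  let ?d = "schur lam - u_vec lam"
  have eq: "Poly_Mapping.lookup (schur lam) m
      = Poly_Mapping.lookup ?d m + (1 when m = expo lam)" for m
    by (auto simp: lookup_minus u_vec_eq_single[OF partition_nonneg[OF assms]] lookup_single when_def)
  have "expo lam \<notin> Poly_Mapping.keys ?d"
    using schur_unitriangular(2)[OF assms] by blast
  then show "Poly_Mapping.lookup (schur lam) (expo lam) = 1"
    unfolding eq by (simp add: in_keys_iff)
  show "mono_energy m > mono_energy (expo lam)"
    if "Poly_Mapping.lookup (schur lam) m \<noteq> 0" "m \<noteq> expo lam"
    using that schur_unitriangular(2)[OF assms] by (simp add: eq in_keys_iff)
  show "mono_degree m = mono_degree (expo lam)"
    if "Poly_Mapping.lookup (schur lam) m \<noteq> 0"
    using that schur_unitriangular(1)[OF assms, of m] by (cases "m = expo lam") (auto simp: eq in_keys_iff)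
qed

lemma schur_0: "schur 0 = 1"
proof -
  have part: "is_partition 0" by (simp add: is_partition_def)
  have "m \<notin> Poly_Mapping.keys (schur 0 - u_vec 0)" for m
  proof
    assume m: "m \<in> Poly_Mapping.keys (schur 0 - u_vec 0)"
    have "mono_degree m = 0" "mono_energy m > 0"
      using schur_unitriangular[OF part m]
      by (simp_all add: expo_def mono_degree_def mono_energy_def)
    then show False using mono_degree_eq_0[of m] by (simp add: mono_energy_def)
  qed
  then have "schur 0 - u_vec 0 = 0" by (metis all_not_in_conv keys_eq_empty)
  then show ?thesis by (simp add: u_vec_def)
qed

section \<open>The Schur basis\<close>

definition homogeneous :: "int \<Rightarrow> upoly \<Rightarrow> bool" where
  "homogeneous n p \<longleftrightarrow> (\<forall>m\<in>Poly_Mapping.keys p. mono_degree m = n)"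

lemma homogeneous_mult:
  assumes "homogeneous a p" "homogeneous b q"
  shows "homogeneous (a + b) (p * q)"
  using assms keys_mult[of p q] unfolding homogeneous_def mono_degree_def
  by (fastforce simp: weight_add)

lemma homogeneous_schur: "lam \<in> partitions n \<Longrightarrow> homogeneous n (schur lam)"
  unfolding homogeneous_def partitions_def using lookup_schur(3) by (auto simp: in_keys_iff)

lemma homogeneous_u_vec: "lam \<in> partitions n \<Longrightarrow> homogeneous n (u_vec lam)"
  unfolding homogeneous_def partitions_def by (auto simp: u_vec_eq_single partition_nonneg)

text \<open>In a linear relation, consider a partition of least energy among those with nonzero
  coefficient. By triangularity its monomial occurs in no other term.\<close>

lemma schur_independent:
  assumes F: "finite F" "F \<subseteq> Collect is_partition"
    and zero: "(\<Sum>lam\<in>F. of_int (a lam) * schur lam) = 0" and lam: "lam \<in> F"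
  shows "a lam = 0"
proof (rule ccontr)
  define G where "G = {\<mu>\<in>F. a \<mu> \<noteq> 0}"
  assume "a lam \<noteq> 0"
  then have G: "finite G" "G \<noteq> {}" using F lam by (auto simp: G_def)
  define \<kappa> where "\<kappa> = arg_min_on (mono_energy \<circ> expo) G"
  have min: "mono_energy (expo \<kappa>) \<le> mono_energy (expo \<mu>)" if "\<mu> \<in> G" for \<mu>
    using arg_min_least[OF G that, of "mono_energy \<circ> expo"] by (auto simp: \<kappa>_def)
  have \<kappa>: "\<kappa> \<in> G" using arg_min_if_finite(1)[OF G] by (auto simp: \<kappa>_def)
  have part: "is_partition \<mu>" if "\<mu> \<in> F" for \<mu> using that F by auto
  have other: "a \<mu> * Poly_Mapping.lookup (schur \<mu>) (expo \<kappa>) = 0" if "\<mu> \<in> F - {\<kappa>}" for \<mu>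
  proof (cases "\<mu> \<in> G")
    case True
    have "expo \<kappa> \<noteq> expo \<mu>"
      using that \<kappa> part inj_onD[OF inj_on_expo, of \<kappa> \<mu>] by (auto simp: G_def)
    then show ?thesis
      using min[OF True] lookup_schur(2)[of \<mu> "expo \<kappa>"] part that by fastforce
  qed (use that in \<open>auto simp: G_def\<close>)
  have "0 = Poly_Mapping.lookup (\<Sum>\<mu>\<in>F. of_int (a \<mu>) * schur \<mu>) (expo \<kappa>)"
    unfolding zero by simp
  also have "\<dots> = (\<Sum>\<mu>\<in>F. a \<mu> * Poly_Mapping.lookup (schur \<mu>) (expo \<kappa>))"
    by (simp add: lookup_sum of_int_mult_eq_frag_cmul)
  also have "\<dots> = a \<kappa> * Poly_Mapping.lookup (schur \<kappa>) (expo \<kappa>)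
      + (\<Sum>\<mu>\<in>F - {\<kappa>}. a \<mu> * Poly_Mapping.lookup (schur \<mu>) (expo \<kappa>))"
    using F(1) \<kappa> by (intro sum.remove) (auto simp: G_def)
  also have "\<dots> = a \<kappa>"
  proof -
    have "(\<Sum>\<mu>\<in>F - {\<kappa>}. a \<mu> * Poly_Mapping.lookup (schur \<mu>) (expo \<kappa>)) = 0"
      using other by (intro sum.neutral) blast
    then show ?thesis using \<kappa> part by (simp add: lookup_schur(1) G_def)
  qed
  finally show False using \<kappa> by (simp add: G_def)
qed

lemma sum_of_bool_mult:
  fixes f :: "'a \<Rightarrow> 'b :: ring_1"
  assumes "finite A" "a \<in> A"
  shows "(\<Sum>x\<in>A. of_int (of_bool (x = a)) * f x) = f a"
proof -
  have "(\<Sum>x\<in>A. of_int (of_bool (x = a)) * f x) = (\<Sum>x\<in>A. if x = a then f x else 0)"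
    by (intro sum.cong) auto
  then show ?thesis using assms by simp
qed

definition schur_span :: "int \<Rightarrow> upoly set" where
  "schur_span n = {p. \<exists>a. p = (\<Sum>lam\<in>partitions n. of_int (a lam) * schur lam)}"

lemma schur_span_sum:
  assumes "\<And>i. i \<in> I \<Longrightarrow> p i \<in> schur_span n"
  shows "(\<Sum>i\<in>I. of_int (c i) * p i) \<in> schur_span n"
proof -
  from assms have "\<forall>i\<in>I. \<exists>a. p i = (\<Sum>lam\<in>partitions n. of_int (a lam) * schur lam)"
    by (simp add: schur_span_def)
  then obtain a where a: "\<And>i. i \<in> I \<Longrightarrow> p i = (\<Sum>lam\<in>partitions n. of_int (a i lam) * schur lam)"
    by metis
  have "(\<Sum>i\<in>I. of_int (c i) * p i)
      = (\<Sum>i\<in>I. \<Sum>lam\<in>partitions n. of_int (c i * a i lam) * schur lam)"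
    by (simp add: a sum_distrib_left mult.assoc)
  also have "\<dots> = (\<Sum>lam\<in>partitions n. of_int (\<Sum>i\<in>I. c i * a i lam) * schur lam)"
    by (subst sum.swap) (simp add: sum_distrib_right)
  finally show ?thesis
    unfolding schur_span_def
    by (intro CollectI exI[of _ "\<lambda>lam. \<Sum>i\<in>I. c i * a i lam"])
qed

lemma sum_monomials:
  fixes p :: upoly
  shows "p = (\<Sum>m\<in>Poly_Mapping.keys p. of_int (Poly_Mapping.lookup p m) * Poly_Mapping.single m 1)"
proof -
  have "p = frag_extend frag_of p" by (rule frag_expansion)
  then show ?thesis by (simp add: frag_extend_def of_int_mult_eq_frag_cmul)
qed

lemma schur_in_span: "lam \<in> partitions n \<Longrightarrow> schur lam \<in> schur_span n"
  unfolding schur_span_def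
  by (intro CollectI exI[of _ "\<lambda>\<mu>. of_bool (\<mu> = lam)"]) (simp only: sum_of_bool_mult finite_partitions)

text \<open>Downward induction on the energy within a degree: the Schur polynomial of the
  partition belonging to \<open>m\<close> differs from \<open>m\<close> by monomials of larger energy. The induction
  measure counts the monomials above \<open>m\<close>.\<close>

lemma monomial_in_schur_span:
  assumes "mono_degree m = n"
  shows "Poly_Mapping.single m 1 \<in> schur_span n"
  using assms
proof (induction "card {m'. mono_degree m' = n \<and> mono_energy m < mono_energy m'}" arbitrary: m
    rule: less_induct)
  case less
  obtain lam where lam: "is_partition lam" "expo lam = m" by (rule expo_surj)
  let ?d = "schur lam - u_vec lam"
  have "Poly_Mapping.single m' 1 \<in> schur_span n" if "m' \<in> Poly_Mapping.keys ?d" for m'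
  proof (rule less.hyps)
    have m': "mono_degree m' = n" "mono_energy m' > mono_energy m"
      using schur_unitriangular[OF lam(1) that] lam(2) less.prems by auto
    show "card {x. mono_degree x = n \<and> mono_energy m' < mono_energy x}
        < card {x. mono_degree x = n \<and> mono_energy m < mono_energy x}"
      using m' by (intro psubset_card_mono finite_subset[OF _ finite_mono_degree[of n]]) auto
    show "mono_degree m' = n" by fact
  qed
  then have "(\<Sum>m'\<in>Poly_Mapping.keys ?d. of_int (Poly_Mapping.lookup ?d m') * Poly_Mapping.single m' 1)
      \<in> schur_span n"
    by (rule schur_span_sum)
  then have d: "?d \<in> schur_span n" by (simp flip: sum_monomials)
  have s: "schur lam \<in> schur_span n"
    using lam less.prems by (intro schur_in_span) (simp add: partitions_def)
  \<comment> \<open>the difference \<open>schur lam - ?d\<close>, written as a sum over two indices\<close>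
  have "(\<Sum>b\<in>{True, False}. of_int (if b then 1 else - 1) * (if b then schur lam else ?d)) \<in> schur_span n"
    by (rule schur_span_sum) (use d s in auto)
  then show ?case
    using lam by (simp add: u_vec_eq_single partition_nonneg)
qed

lemma homogeneous_in_schur_span:
  assumes "homogeneous n p"
  shows "p \<in> schur_span n"
proof -
  have "(\<Sum>m\<in>Poly_Mapping.keys p. of_int (Poly_Mapping.lookup p m) * Poly_Mapping.single m 1) \<in> schur_span n"
    using assms by (intro schur_span_sum monomial_in_schur_span) (auto simp: homogeneous_def)
  then show ?thesis by (simp flip: sum_monomials)
qed

text \<open>The coefficients can be read off any expansion. This identifies the description
  defining \<open>schur_coeffs\<close>, whose uniqueness ranges over partitions of all degrees, so the
  competing expansion need not be homogeneous.\<close>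

lemma lookup_schur_coeffs_sum:
  fixes a :: "intvec \<Rightarrow> int" and n :: int
  defines "p \<equiv> (\<Sum>lam\<in>partitions n. of_int (a lam) * schur lam)"
  shows "Poly_Mapping.lookup (schur_coeffs p) lam = (a lam when lam \<in> partitions n)"
proof -
  have supp: "finite {lam. (a lam when lam \<in> partitions n) \<noteq> 0}"
    by (rule finite_subset[OF _ finite_partitions[of n]]) (auto simp: when_def)
  define c where "c = Abs_poly_mapping (\<lambda>lam. a lam when lam \<in> partitions n)"
  have lookup: "Poly_Mapping.lookup c lam = (a lam when lam \<in> partitions n)" for lam
    unfolding c_def by (simp add: lookup_Abs_poly_mapping[OF supp])
  have keys: "Poly_Mapping.keys c \<subseteq> partitions n"
    by (auto simp: in_keys_iff lookup when_def split: if_splits)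
  have comb: "(\<Sum>lam\<in>Poly_Mapping.keys d. of_int (Poly_Mapping.lookup d lam) * schur lam)
      = (\<Sum>lam\<in>F. of_int (Poly_Mapping.lookup d lam) * schur lam)"
    if "finite F" "Poly_Mapping.keys d \<subseteq> F" for F d
    using that by (intro sum.mono_neutral_left) (auto simp: in_keys_iff)
  have pc: "p = (\<Sum>lam\<in>Poly_Mapping.keys c. of_int (Poly_Mapping.lookup c lam) * schur lam)"
    unfolding comb[OF finite_partitions keys] unfolding p_def lookup by (intro sum.cong) auto
  have "schur_coeffs p = c"
    unfolding schur_coeffs_def
  proof (rule the_equality, intro conjI)
    show "Poly_Mapping.keys c \<subseteq> {lam. is_partition lam}" using keys partitionsD by auto
    show "p = (\<Sum>lam\<in>Poly_Mapping.keys c. of_int (Poly_Mapping.lookup c lam) * schur lam)"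
      by (rule pc)
  next
    fix d
    assume d: "Poly_Mapping.keys d \<subseteq> {lam. is_partition lam} \<and>
      p = (\<Sum>lam\<in>Poly_Mapping.keys d. of_int (Poly_Mapping.lookup d lam) * schur lam)"
    define F where "F = Poly_Mapping.keys d \<union> partitions n"
    have F: "finite F" "F \<subseteq> Collect is_partition" "Poly_Mapping.keys d \<subseteq> F" "Poly_Mapping.keys c \<subseteq> F"
      using d keys by (auto simp: F_def dest: partitionsD)
    have "p = (\<Sum>lam\<in>F. of_int (Poly_Mapping.lookup c lam) * schur lam)"
      using pc by (simp only: comb[OF F(1,4)])
    moreover have "p = (\<Sum>lam\<in>F. of_int (Poly_Mapping.lookup d lam) * schur lam)"
      using d by (simp only: comb[OF F(1,3)])
    ultimately have zero: "(\<Sum>lam\<in>F. of_int (Poly_Mapping.lookup d lam - Poly_Mapping.lookup c lam) * schur lam) = 0"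
      by (simp add: left_diff_distrib sum_subtractf)
    have "Poly_Mapping.lookup d lam = Poly_Mapping.lookup c lam" for lam
    proof (cases "lam \<in> F")
      case True
      then show ?thesis using schur_independent[OF F(1,2) zero] by simp
    next
      case False
      then show ?thesis using F(3,4) by (metis in_keys_iff subsetD)
    qed
    then show "d = c" by (rule poly_mapping_eqI)
  qed
  then show ?thesis by (simp add: lookup)
qed

lemma schur_expansion:
  assumes "homogeneous n p"
  shows "p = (\<Sum>lam\<in>partitions n. of_int (Poly_Mapping.lookup (schur_coeffs p) lam) * schur lam)"
    and "lam \<notin> partitions n \<Longrightarrow> Poly_Mapping.lookup (schur_coeffs p) lam = 0"
proof -
  obtain a where a: "p = (\<Sum>lam\<in>partitions n. of_int (a lam) * schur lam)"
    using homogeneous_in_schur_span[OF assms] by (auto simp: schur_span_def)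
  note c = lookup_schur_coeffs_sum[of a n, folded a]
  show "p = (\<Sum>lam\<in>partitions n. of_int (Poly_Mapping.lookup (schur_coeffs p) lam) * schur lam)"
    unfolding c by (subst a) (rule sum.cong, auto)
  show "Poly_Mapping.lookup (schur_coeffs p) lam = 0" if "lam \<notin> partitions n"
    using that by (simp add: c)
qed

section \<open>Kostka numbers\<close>

lemma kostka_eq_0:
  assumes "\<mu> \<in> partitions a" "\<nu> \<in> partitions k" "lam \<notin> partitions (k + a)"
  shows "kostka lam \<mu> \<nu> = 0"
  unfolding kostka_def using assms
  by (intro schur_expansion(2)[of "k + a"] homogeneous_mult homogeneous_schur homogeneous_u_vec)

lemma structure_const_eq_0:
  assumes "\<mu> \<in> partitions a" "\<nu> \<in> partitions k" "lam \<notin> partitions (k + a)"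
  shows "structure_const lam \<mu> \<nu> = 0"
  unfolding structure_const_def using assms
  by (subst mult.commute, intro schur_expansion(2)[of "k + a"] homogeneous_mult homogeneous_schur)

lemma u_vec_eq_sum_schur:
  assumes "\<nu> \<in> partitions k"
  shows "u_vec \<nu> = (\<Sum>\<kappa>\<in>partitions k. of_int (kostka \<kappa> 0 \<nu>) * schur \<kappa>)"
  using schur_expansion(1)[OF homogeneous_u_vec[OF assms]] by (simp add: kostka_def schur_0)

lemma schur_eq_sum_u_vec:
  assumes "\<kappa> \<in> partitions k"
  shows "schur \<kappa> = (\<Sum>\<nu>\<in>partitions k. of_int (Poly_Mapping.lookup (schur \<kappa>) (expo \<nu>)) * u_vec \<nu>)"
proof (rule poly_mapping_eqI)
  fix m
  obtain \<mu> where \<mu>: "is_partition \<mu>" "expo \<mu> = m" by (rule expo_surj)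
  have "Poly_Mapping.lookup (\<Sum>\<nu>\<in>partitions k. of_int (Poly_Mapping.lookup (schur \<kappa>) (expo \<nu>)) * u_vec \<nu>) m
     = (\<Sum>\<nu>\<in>partitions k. if \<nu> = \<mu> then Poly_Mapping.lookup (schur \<kappa>) (expo \<nu>) else 0)"
    unfolding lookup_sum of_int_mult_eq_frag_cmul lookup_frag_cmul
  proof (rule sum.cong)
    fix \<nu> assume "\<nu> \<in> partitions k"
    then have part: "is_partition \<nu>" by (rule partitionsD)
    then have "expo \<nu> = m \<longleftrightarrow> \<nu> = \<mu>"
      using \<mu> inj_onD[OF inj_on_expo, of \<nu> \<mu>] by auto
    then show "Poly_Mapping.lookup (schur \<kappa>) (expo \<nu>) * Poly_Mapping.lookup (u_vec \<nu>) m
        = (if \<nu> = \<mu> then Poly_Mapping.lookup (schur \<kappa>) (expo \<nu>) else 0)"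
      by (auto simp: u_vec_eq_single partition_nonneg part lookup_single when_def)
  qed simp
  also have "\<dots> = (if \<mu> \<in> partitions k then Poly_Mapping.lookup (schur \<kappa>) m else 0)"
    by (simp add: \<mu>(2))
  also have "\<dots> = Poly_Mapping.lookup (schur \<kappa>) m"
    using lookup_schur(3)[of \<kappa> m] assms \<mu> by (auto simp: partitions_def)
  finally show "Poly_Mapping.lookup (schur \<kappa>) m = Poly_Mapping.lookup
      (\<Sum>\<nu>\<in>partitions k. of_int (Poly_Mapping.lookup (schur \<kappa>) (expo \<nu>)) * u_vec \<nu>) m" ..
qed

text \<open>The two product identities come from substituting the expansions of \<open>u\<close> by \<open>U\<close> and of
  \<open>U\<close> by \<open>u\<close> into each other, in either order, and comparing coefficients. Both are
  needed: one gives the existence of \<open>t\<close>, the other its uniqueness.\<close>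

lemma kostka_right_inverse:
  assumes "lam \<in> partitions k" "\<kappa> \<in> partitions k"
  shows "(\<Sum>\<nu>\<in>partitions k. Poly_Mapping.lookup (schur \<kappa>) (expo \<nu>) * kostka lam 0 \<nu>) = of_bool (\<kappa> = lam)"
proof -
  let ?L = "\<lambda>\<nu>. Poly_Mapping.lookup (schur \<kappa>) (expo \<nu>)"
  let ?a = "\<lambda>lam. \<Sum>\<nu>\<in>partitions k. ?L \<nu> * kostka lam 0 \<nu>"
  have "schur \<kappa> = (\<Sum>\<nu>\<in>partitions k. of_int (?L \<nu>) * u_vec \<nu>)"
    by (rule schur_eq_sum_u_vec[OF assms(2)])
  also have "\<dots> = (\<Sum>\<nu>\<in>partitions k. \<Sum>lam\<in>partitions k. of_int (?L \<nu> * kostka lam 0 \<nu>) * schur lam)"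
    by (simp add: u_vec_eq_sum_schur sum_distrib_left mult.assoc)
  also have "\<dots> = (\<Sum>lam\<in>partitions k. of_int (?a lam) * schur lam)"
    by (subst sum.swap) (simp add: sum_distrib_right)
  finally have 1: "schur \<kappa> = (\<Sum>lam\<in>partitions k. of_int (?a lam) * schur lam)" .
  have 2: "schur \<kappa> = (\<Sum>lam\<in>partitions k. of_int (of_bool (lam = \<kappa>)) * schur lam)"
    using assms(2) by (simp only: sum_of_bool_mult finite_partitions)
  show ?thesis
    using lookup_schur_coeffs_sum[of ?a k lam] lookup_schur_coeffs_sum[of "\<lambda>lam. of_bool (lam = \<kappa>)" k lam] assms(1)
    unfolding 1[symmetric] 2[symmetric] by (simp add: eq_commute[of \<kappa>])
qed

lemma kostka_left_inverse:
  assumes "\<mu> \<in> partitions k" "\<nu> \<in> partitions k"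
  shows "(\<Sum>lam\<in>partitions k. kostka lam 0 \<mu> * Poly_Mapping.lookup (schur lam) (expo \<nu>)) = of_bool (\<mu> = \<nu>)"
proof -
  have part: "is_partition \<mu>" "is_partition \<nu>" using assms by (auto dest: partitionsD)
  then have eq: "expo \<nu> = expo \<mu> \<longleftrightarrow> \<mu> = \<nu>" using inj_onD[OF inj_on_expo, of \<mu> \<nu>] by auto
  have "(\<Sum>lam\<in>partitions k. kostka lam 0 \<mu> * Poly_Mapping.lookup (schur lam) (expo \<nu>))
      = Poly_Mapping.lookup (u_vec \<mu>) (expo \<nu>)"
    by (simp add: u_vec_eq_sum_schur[OF assms(1)] lookup_sum of_int_mult_eq_frag_cmul)
  also have "\<dots> = of_bool (\<mu> = \<nu>)"
    using part by (simp add: u_vec_eq_single partition_nonneg lookup_single when_def eq)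
  finally show ?thesis .
qed

lemma zero_in_partitions: "0 \<in> partitions 0"
  by (simp add: partitions_def is_partition_def expo_def mono_degree_def)

lemma Sum_any_kostka:
  assumes "lam \<in> partitions l" "\<mu> \<in> partitions a"
  shows "Sum_any (\<lambda>\<nu>. of_int (kostka lam \<mu> \<nu>) * t \<nu> when is_partition \<nu>)
    = (\<Sum>\<nu>\<in>partitions (l - a). of_int (kostka lam \<mu> \<nu>) * t \<nu> :: upoly)"
proof -
  have "\<nu> \<in> partitions (l - a)" if "(of_int (kostka lam \<mu> \<nu>) * t \<nu> when is_partition \<nu>) \<noteq> 0" for \<nu>
  proof -
    have \<nu>: "is_partition \<nu>" "kostka lam \<mu> \<nu> \<noteq> 0" using that by (auto simp: when_def split: if_splits)
    then have mem: "\<nu> \<in> partitions (mono_degree (expo \<nu>))" by (simp add: partitions_def)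
    then have "lam \<in> partitions (mono_degree (expo \<nu>) + a)"
      using kostka_eq_0[OF assms(2) mem] \<nu>(2) by blast
    then show ?thesis using mem assms(1) by (auto simp: partitions_def)
  qed
  then have "Sum_any (\<lambda>\<nu>. of_int (kostka lam \<mu> \<nu>) * t \<nu> when is_partition \<nu>)
      = (\<Sum>\<nu>\<in>partitions (l - a). of_int (kostka lam \<mu> \<nu>) * t \<nu> when is_partition \<nu>)"
    by (intro Sum_any.expand_superset) auto
  also have "\<dots> = (\<Sum>\<nu>\<in>partitions (l - a). of_int (kostka lam \<mu> \<nu>) * t \<nu>)"
    by (intro sum.cong) (auto dest: partitionsD)
  finally show ?thesis .
qed

text \<open>The defining system of \<open>t\<close> splits into one finite square system for each degree, which
  the inverse Kostka matrix solves.\<close>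

lemma schur_eq_sum_t_basis:
  assumes "lam \<in> partitions k"
  shows "schur lam = (\<Sum>\<mu>\<in>partitions k. of_int (kostka lam 0 \<mu>) * t_basis \<mu>)"
proof -
  define good :: "(intvec \<Rightarrow> upoly) \<Rightarrow> bool" where "good t \<longleftrightarrow>
     (\<forall>lam. is_partition lam \<longrightarrow>
        schur lam = Sum_any (\<lambda>\<mu>. of_int (kostka lam 0 \<mu>) * t \<mu> when is_partition \<mu>)) \<and>
     (\<forall>\<mu>. \<not> is_partition \<mu> \<longrightarrow> t \<mu> = 0)" for t
  have good_iff: "good t \<longleftrightarrow>
     (\<forall>n. \<forall>lam\<in>partitions n. schur lam = (\<Sum>\<mu>\<in>partitions n. of_int (kostka lam 0 \<mu>) * t \<mu>)) \<and>
     (\<forall>\<mu>. \<not> is_partition \<mu> \<longrightarrow> t \<mu> = 0)" for t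
    unfolding good_def using Sum_any_kostka[OF _ zero_in_partitions, of _ _ t]
    by (auto simp: partitions_def)
  define t :: "intvec \<Rightarrow> upoly" where "t \<nu> = (if is_partition \<nu> then
      \<Sum>\<kappa>\<in>partitions (mono_degree (expo \<nu>)). of_int (Poly_Mapping.lookup (schur \<kappa>) (expo \<nu>)) * schur \<kappa>
      else 0)" for \<nu>
  have t: "t \<nu> = (\<Sum>\<kappa>\<in>partitions n. of_int (Poly_Mapping.lookup (schur \<kappa>) (expo \<nu>)) * schur \<kappa>)"
    if "\<nu> \<in> partitions n" for \<nu> n
    using that by (auto simp: t_def partitions_def)
  have "good t"
    unfolding good_iff
  proof (intro conjI allI ballI impI)
    fix n lam assume lam: "lam \<in> partitions n"
    have "(\<Sum>\<mu>\<in>partitions n. of_int (kostka lam 0 \<mu>) * t \<mu>)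
        = (\<Sum>\<mu>\<in>partitions n. \<Sum>\<kappa>\<in>partitions n.
            of_int (Poly_Mapping.lookup (schur \<kappa>) (expo \<mu>) * kostka lam 0 \<mu>) * schur \<kappa>)"
      by (simp add: t sum_distrib_left mult_ac)
    also have "\<dots> = (\<Sum>\<kappa>\<in>partitions n. of_int (\<Sum>\<mu>\<in>partitions n.
            Poly_Mapping.lookup (schur \<kappa>) (expo \<mu>) * kostka lam 0 \<mu>) * schur \<kappa>)"
      by (subst sum.swap) (simp add: sum_distrib_right)
    also have "\<dots> = (\<Sum>\<kappa>\<in>partitions n. of_int (of_bool (\<kappa> = lam)) * schur \<kappa>)"
      by (intro sum.cong refl) (simp only: kostka_right_inverse[OF lam])
    also have "\<dots> = schur lam"
      using lam by (simp only: sum_of_bool_mult finite_partitions)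
    finally show "schur lam = (\<Sum>\<mu>\<in>partitions n. of_int (kostka lam 0 \<mu>) * t \<mu>)" ..
  qed (simp add: t_def)
  moreover have "t' = t" if "good t'" for t'
  proof
    fix \<nu>
    show "t' \<nu> = t \<nu>"
    proof (cases "is_partition \<nu>")
      case True
      define n where "n = mono_degree (expo \<nu>)"
      have \<nu>: "\<nu> \<in> partitions n" using True by (simp add: n_def partitions_def)
      have t': "schur \<kappa> = (\<Sum>\<mu>\<in>partitions n. of_int (kostka \<kappa> 0 \<mu>) * t' \<mu>)"
        if "\<kappa> \<in> partitions n" for \<kappa>
        using \<open>good t'\<close> that unfolding good_iff by blast
      have "t \<nu> = (\<Sum>\<kappa>\<in>partitions n. of_int (Poly_Mapping.lookup (schur \<kappa>) (expo \<nu>)) * schur \<kappa>)"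
        by (rule t[OF \<nu>])
      also have "\<dots> = (\<Sum>\<kappa>\<in>partitions n. of_int (Poly_Mapping.lookup (schur \<kappa>) (expo \<nu>)) *
            (\<Sum>\<mu>\<in>partitions n. of_int (kostka \<kappa> 0 \<mu>) * t' \<mu>))"
        by (intro sum.cong refl arg_cong2[of _ _ _ _ "(*)"] t')
      also have "\<dots> = (\<Sum>\<kappa>\<in>partitions n. \<Sum>\<mu>\<in>partitions n.
            of_int (kostka \<kappa> 0 \<mu> * Poly_Mapping.lookup (schur \<kappa>) (expo \<nu>)) * t' \<mu>)"
        by (simp add: sum_distrib_left mult_ac)
      also have "\<dots> = (\<Sum>\<mu>\<in>partitions n. of_int (\<Sum>\<kappa>\<in>partitions n.
            kostka \<kappa> 0 \<mu> * Poly_Mapping.lookup (schur \<kappa>) (expo \<nu>)) * t' \<mu>)"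
        by (subst sum.swap) (simp add: sum_distrib_right)
      also have "\<dots> = (\<Sum>\<mu>\<in>partitions n. of_int (of_bool (\<mu> = \<nu>)) * t' \<mu>)"
        by (intro sum.cong refl) (simp only: kostka_left_inverse[OF _ \<nu>])
      also have "\<dots> = t' \<nu>"
        using \<nu> by (simp only: sum_of_bool_mult finite_partitions)
      finally show ?thesis ..
    qed (use \<open>good t'\<close> in \<open>simp add: good_iff t_def\<close>)
  qed
  ultimately have "good t_basis"
    unfolding t_basis_def good_def[symmetric] by (rule theI)
  then show ?thesis using assms by (simp add: good_iff)
qed

text \<open>Both sides are the coefficient of \<open>U\<^sub>\<lambda>\<close> in \<open>u\<^sub>\<nu> U\<^sub>\<mu>\<close>, the right one after expanding
  \<open>u\<^sub>\<nu>\<close> first.\<close>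

lemma kostka_eq_sum_structure_const:
  assumes "\<mu> \<in> partitions a" "\<nu> \<in> partitions k" "lam \<in> partitions (k + a)"
  shows "kostka lam \<mu> \<nu> = (\<Sum>\<kappa>\<in>partitions k. kostka \<kappa> 0 \<nu> * structure_const lam \<mu> \<kappa>)"
proof -
  let ?a = "\<lambda>lam. \<Sum>\<kappa>\<in>partitions k. kostka \<kappa> 0 \<nu> * structure_const lam \<mu> \<kappa>"
  have prod: "schur \<kappa> * schur \<mu> = (\<Sum>lam\<in>partitions (k + a). of_int (structure_const lam \<mu> \<kappa>) * schur lam)"
    if "\<kappa> \<in> partitions k" for \<kappa>
    unfolding structure_const_def mult.commute[of "schur \<mu>"]
    using that assms(1) by (intro schur_expansion(1) homogeneous_mult homogeneous_schur)
  have "u_vec \<nu> * schur \<mu> = (\<Sum>\<kappa>\<in>partitions k. of_int (kostka \<kappa> 0 \<nu>) * (schur \<kappa> * schur \<mu>))"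
    by (simp add: u_vec_eq_sum_schur[OF assms(2)] sum_distrib_right mult.assoc)
  also have "\<dots> = (\<Sum>\<kappa>\<in>partitions k. \<Sum>lam\<in>partitions (k + a).
      of_int (kostka \<kappa> 0 \<nu> * structure_const lam \<mu> \<kappa>) * schur lam)"
    by (simp add: prod sum_distrib_left mult.assoc)
  also have "\<dots> = (\<Sum>lam\<in>partitions (k + a). of_int (?a lam) * schur lam)"
    by (subst sum.swap) (simp add: sum_distrib_right)
  finally show ?thesis
    unfolding kostka_def[of lam \<mu> \<nu>] using lookup_schur_coeffs_sum[of ?a "k + a" lam] assms(3) by simp
qed

theorem mainTheorem6:
  fixes lam \<mu> :: intvec
  assumes "is_partition lam" and "is_partition \<mu>" and "contained \<mu> lam"
  shows "skew_schur lam \<mu> =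
    Sum_any (\<lambda>\<nu>. of_int (structure_const lam \<mu> \<nu>) * schur \<nu> when is_partition \<nu>)"
proof -
  define l a where "l = mono_degree (expo lam)" and "a = mono_degree (expo \<mu>)"
  define k where "k = l - a"
  have lam: "lam \<in> partitions l" and \<mu>: "\<mu> \<in> partitions a"
    using assms by (simp_all add: partitions_def l_def a_def)
  have lam': "lam \<in> partitions (k + a)" using lam by (simp add: k_def)
  have "skew_schur lam \<mu> = (\<Sum>\<nu>\<in>partitions k. of_int (kostka lam \<mu> \<nu>) * t_basis \<nu>)"
    unfolding skew_schur_def k_def by (rule Sum_any_kostka[OF lam \<mu>])
  also have "\<dots> = (\<Sum>\<nu>\<in>partitions k. \<Sum>\<kappa>\<in>partitions k.
      of_int (structure_const lam \<mu> \<kappa>) * (of_int (kostka \<kappa> 0 \<nu>) * t_basis \<nu>))"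
    by (simp add: kostka_eq_sum_structure_const[OF \<mu> _ lam'] sum_distrib_left mult_ac)
  also have "\<dots> = (\<Sum>\<kappa>\<in>partitions k. of_int (structure_const lam \<mu> \<kappa>) * schur \<kappa>)"
    by (subst sum.swap) (simp add: schur_eq_sum_t_basis sum_distrib_left)
  also have "\<dots> = (\<Sum>\<kappa>\<in>partitions k. of_int (structure_const lam \<mu> \<kappa>) * schur \<kappa> when is_partition \<kappa>)"
    by (intro sum.cong) (auto dest: partitionsD)
  also have "\<dots> = Sum_any (\<lambda>\<nu>. of_int (structure_const lam \<mu> \<nu>) * schur \<nu> when is_partition \<nu>)"
  proof (rule Sum_any.expand_superset[symmetric])
    show "{\<nu>. (of_int (structure_const lam \<mu> \<nu>) * schur \<nu> when is_partition \<nu>) \<noteq> 0} \<subseteq> partitions k"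
    proof clarify
      fix \<nu> assume "(of_int (structure_const lam \<mu> \<nu>) * schur \<nu> when is_partition \<nu>) \<noteq> 0"
      then have \<nu>: "is_partition \<nu>" "structure_const lam \<mu> \<nu> \<noteq> 0"
        by (auto simp: when_def split: if_splits)
      then have mem: "\<nu> \<in> partitions (mono_degree (expo \<nu>))" by (simp add: partitions_def)
      then have "lam \<in> partitions (mono_degree (expo \<nu>) + a)"
        using structure_const_eq_0[OF \<mu> mem] \<nu>(2) by blast
      then show "\<nu> \<in> partitions k" using mem lam by (auto simp: partitions_def k_def)
    qed
  qed simp
  finally show ?thesis .
qed

end
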